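(* Let $k,q,t\in\mathbb N$ be positive integers, let $p=\binom{2k+1}{k+1}$, assume $q\ge p+1$, and let $q'=\binom{q}{p}$. Then $$r_{2k+1}\big(\hat H_t^{(2k+1)};q',2\big)>r_{k+1}(t;q,p+1)-1.$$
   Context: $K_n^{(k)}$ is the complete $k$-uniform hypergraph on $n$ vertices. For a $k$-uniform hypergraph $G$ and integers $q\ge p$, $r_k(G;q,p)$ is the smallest integer $n$ such that in every colouring of the edges of $K_n^{(k)}$ with $q$ colours there is a (not necessarily induced) copy of $G$ whose edges receive fewer than $p$ distinct colours in total. We write $r_k(t;q,p)$ for $r_k(K_t^{(k)};q,p)$. The $k$-uniform balanced hedgehog $\hat H_t^{(k)}$ with body of order $t$ is the following $k$-uniform hypergraph: take a set $S$ of $t$ vertices (the body), and for each subset $X\subset S$ with $|X|=\lceil k/2\rceil$ add one $k$-edge $e$ with $e\cap S=X$, in such a way that any two distinct edges $e,f$ satisfy $e\cap f\subset S$. The vertex set consists of $S$ and the vertices of these edges. *)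

theory Defs
  imports Complex_Main "HOL-Library.Ramsey"
begin

type_synonym 'a hypergraph = "'a set \<times> 'a set set"

definition verts :: "'a hypergraph \<Rightarrow> 'a set" where
  "verts G = fst G"

definition edges :: "'a hypergraph \<Rightarrow> 'a set set" where
  "edges G = snd G"

definition uniform_hypergraph :: "nat \<Rightarrow> 'a hypergraph \<Rightarrow> bool" where
  "uniform_hypergraph k G \<longleftrightarrow> finite (verts G) \<and> edges G \<subseteq> nsets (verts G) k"

definition complete_hypergraph :: "nat \<Rightarrow> nat \<Rightarrow> nat hypergraph" where
  "complete_hypergraph k n = ({..<n}, nsets {..<n} k)"

text \<open>The copy of \<open>G\<close> given by an embedding \<open>f\<close> has the edges \<open>f ` e\<close> with \<open>e\<close> an edge of \<open>G\<close>;
  it need not be induced.\<close>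

definition embedding :: "('a \<Rightarrow> 'b) \<Rightarrow> 'a hypergraph \<Rightarrow> 'b hypergraph \<Rightarrow> bool" where
  "embedding f G H \<longleftrightarrow>
     inj_on f (verts G) \<and> f ` verts G \<subseteq> verts H \<and> (\<forall>e\<in>edges G. f ` e \<in> edges H)"

text \<open>The least element exists for every \<open>k\<close>-uniform \<open>G\<close> and \<open>p \<ge> 2\<close>, by Ramsey's theorem.\<close>

definition ramsey_number :: "nat \<Rightarrow> 'a hypergraph \<Rightarrow> nat \<Rightarrow> nat \<Rightarrow> nat" where
  "ramsey_number k G q p =
     (LEAST n. \<forall>c :: nat set \<Rightarrow> nat. c ` edges (complete_hypergraph k n) \<subseteq> {..<q} \<longrightarrow>
        (\<exists>f. embedding f G (complete_hypergraph k n) \<and>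
             card ((\<lambda>e. c (f ` e)) ` edges G) < p))"

text \<open>The hedgehog is determined only up to isomorphism, so it is a predicate;
  \<open>ex_balanced_hedgehog\<close> below provides an instance for all parameters.\<close>

definition balanced_hedgehog :: "nat \<Rightarrow> nat \<Rightarrow> 'a hypergraph \<Rightarrow> bool" where
  "balanced_hedgehog k t G \<longleftrightarrow> uniform_hypergraph k G \<and>
     (\<exists>S. finite S \<and> card S = t \<and>
        verts G = S \<union> \<Union>(edges G) \<and>
        (\<forall>e\<in>edges G. e \<inter> S \<in> nsets S (nat \<lceil>real k / 2\<rceil>)) \<and>
        (\<forall>X\<in>nsets S (nat \<lceil>real k / 2\<rceil>). \<exists>!e. e \<in> edges G \<and> e \<inter> S = X) \<and>
        (\<forall>e\<in>edges G. \<forall>f\<in>edges G. e \<noteq> f \<longrightarrow> e \<inter> f \<subseteq> S))"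

lemma ex_balanced_hedgehog:
  "\<exists>G :: (nat + nat set \<times> nat) hypergraph. balanced_hedgehog k t G"
proof -
  define h where "h = nat \<lceil>real k / 2\<rceil>"
  have hk: "h \<le> k" unfolding h_def by linarith
  define S :: "(nat + nat set \<times> nat) set" where "S = Inl ` {..<t}"
  define edge :: "nat set \<Rightarrow> (nat + nat set \<times> nat) set"
    where "edge X = Inl ` X \<union> (\<lambda>j. Inr (X, j)) ` {..<k - h}" for X
  define E where "E = edge ` nsets {..<t} h"
  define G where "G = (S \<union> \<Union>E, E)"
  have S: "finite S" "card S = t" by (auto simp: S_def card_image)
  have int: "edge X \<inter> S = Inl ` X" if "X \<in> nsets {..<t} h" for X
    using that by (auto simp: edge_def S_def nsets_def)
  have fin: "finite (edge X)" and card: "card (edge X) = k" if "X \<in> nsets {..<t} h" for X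
  proof -
    show "finite (edge X)" using that by (auto simp: edge_def nsets_def)
    have "card (edge X) = card X + (k - h)"
      unfolding edge_def using that
      by (subst card_Un_disjoint) (auto simp: nsets_def card_image inj_on_def)
    then show "card (edge X) = k" using that hk by (simp add: nsets_def)
  qed
  have "finite E" unfolding E_def by (simp add: finite_imp_finite_nsets)
  then have uni: "uniform_hypergraph k G"
    using S fin card by (auto simp: uniform_hypergraph_def verts_def edges_def G_def nsets_def E_def)
  have mem: "e \<inter> S \<in> nsets S h" if "e \<in> E" for e
  proof -
    obtain X where X: "X \<in> nsets {..<t} h" "e = edge X" using \<open>e \<in> E\<close> by (auto simp: E_def)
    then show ?thesis using int[OF X(1)] by (auto simp: nsets_def S_def card_image)
  qed
  have uniq: "\<exists>!e. e \<in> E \<and> e \<inter> S = X" if X: "X \<in> nsets S h" for X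
  proof -
    obtain Y where Y: "Y \<subseteq> {..<t}" "X = Inl ` Y"
      using X by (auto simp: nsets_def S_def subset_image_iff)
    have YY: "Y \<in> nsets {..<t} h"
      using X Y by (auto simp: nsets_def card_image finite_image_iff)
    show ?thesis
    proof (rule ex1I[of _ "edge Y"])
      show "edge Y \<in> E \<and> edge Y \<inter> S = X" using YY int[OF YY] Y by (auto simp: E_def)
      fix e assume e: "e \<in> E \<and> e \<inter> S = X"
      then obtain Z where Z: "Z \<in> nsets {..<t} h" "e = edge Z" by (auto simp: E_def)
      then have "Inl ` Z = (Inl ` Y :: (nat + nat set \<times> nat) set)"
        using int[OF Z(1)] e Y by auto
      then have "Z = Y" by (simp add: inj_image_eq_iff)
      then show "e = edge Y" using Z by simp
    qed
  qed
  have "e \<inter> f \<subseteq> S" if "e \<in> E" "f \<in> E" "e \<noteq> f" for e f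
    using that by (auto simp: E_def edge_def S_def nsets_def)
  then have "balanced_hedgehog k t G"
    unfolding balanced_hedgehog_def h_def[symmetric]
    using uni S mem uniq
    by (intro conjI exI[of _ S]) (auto simp: G_def verts_def edges_def)
  then show ?thesis ..
qed

end

(* Given a colouring of the (k+1)-sets with q colours, colour a (2k+1)-set by a p-set of colours
   containing the colours of all its (k+1)-subsets; there are binom(q,p) such p-sets. In a
   monochromatic hedgehog, every (k+1)-subset of the body lies in an edge, so its colour lies in one
   fixed p-set, and the body spans a complete hypergraph with at most p colours. *)

theory Submission imports Defs begin

lemma edges_complete_hypergraph [simp]: "edges (complete_hypergraph k n) = nsets {..<n} k"
  and verts_complete_hypergraph [simp]: "verts (complete_hypergraph k n) = {..<n}"
  by (simp_all add: complete_hypergraph_def edges_def verts_def)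

lemma nsets_image:
  assumes "inj_on f A" "X \<in> nsets A k"
  shows "f ` X \<in> nsets (f ` A) k"
  using assms by (auto simp: nsets_def card_image inj_on_subset)

lemma ramsey_number_le:
  assumes "\<And>c :: nat set \<Rightarrow> nat. c ` nsets {..<n} k \<subseteq> {..<q} \<Longrightarrow>
    \<exists>f. embedding f G (complete_hypergraph k n) \<and> card ((\<lambda>e. c (f ` e)) ` edges G) < p"
  shows "ramsey_number k G q p \<le> n"
  unfolding ramsey_number_def using assms by (intro Least_le) simp

text \<open>A \<open>LEAST\<close> satisfies its predicate only once some number does. Ramsey's
  theorem supplies one: a monochromatic set of \<open>card (verts G)\<close> vertices carries a copy
  of \<open>G\<close> in at most one colour, which is fewer than \<open>p\<close> because
  \<open>p \<ge> 2\<close>.\<close>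

lemma ramsey_number_embedding:
  fixes c :: "nat set \<Rightarrow> nat"
  assumes G: "uniform_hypergraph k G" and p: "p \<ge> 2"
    and c: "c ` nsets {..<ramsey_number k G q p} k \<subseteq> {..<q}"
  obtains f where "embedding f G (complete_hypergraph k (ramsey_number k G q p))"
    and "card ((\<lambda>e. c (f ` e)) ` edges G) < p"
proof -
  let ?P = "\<lambda>n. \<forall>c :: nat set \<Rightarrow> nat. c ` edges (complete_hypergraph k n) \<subseteq> {..<q} \<longrightarrow>
    (\<exists>f. embedding f G (complete_hypergraph k n) \<and> card ((\<lambda>e. c (f ` e)) ` edges G) < p)"
  obtain N :: nat where N: "partn_lst {..<N} (replicate q (card (verts G))) k"
    using ramsey_full by blast
  have "?P N"
  proof (intro allI impI)
    fix d :: "nat set \<Rightarrow> nat"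
    assume "d ` edges (complete_hypergraph k N) \<subseteq> {..<q}"
    then have "d \<in> nsets {..<N} k \<rightarrow> {..<q}" by auto
    from partn_lstE[OF N this length_replicate] obtain i A
      where "A \<in> nsets {..<N} (card (verts G))" and mono: "d ` nsets A k \<subseteq> {i}"
      by (metis length_replicate nth_replicate)
    then have A: "A \<subseteq> {..<N}" "finite A" "card A = card (verts G)"
      by (auto simp: nsets_def)
    then obtain f where f: "bij_betw f (verts G) A"
      using G finite_same_card_bij unfolding uniform_hypergraph_def by metis
    have edge: "f ` e \<in> nsets A k" if "e \<in> edges G" for e
      using that G f nsets_image[of f "verts G" e k]
      by (auto simp: uniform_hypergraph_def bij_betw_def)
    then have "embedding f G (complete_hypergraph k N)"
      using f A nsets_mono[OF A(1), of k] unfolding embedding_def bij_betw_def by auto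
    moreover have "(\<lambda>e. d (f ` e)) ` edges G \<subseteq> {i}"
      using mono edge by blast
    then have "card ((\<lambda>e. d (f ` e)) ` edges G) \<le> 1"
      using card_mono[of "{i}"] by fastforce
    ultimately show "\<exists>f. embedding f G (complete_hypergraph k N) \<and>
        card ((\<lambda>e. d (f ` e)) ` edges G) < p"
      using p by (intro exI[of _ f]) simp
  qed
  then have "?P (ramsey_number k G q p)"
    unfolding ramsey_number_def by (rule LeastI)
  with c that show thesis
    unfolding edges_complete_hypergraph by blast
qed

text \<open>Half of \<open>2 * k + 1\<close> rounds up to \<open>k + 1\<close>, so every
  \<open>(k + 1)\<close>-subset \<open>X\<close> of the body is the trace
  \<open>e \<inter> S\<close> of some edge \<open>e\<close>, which therefore contains
  \<open>X\<close>.\<close>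

lemma balanced_hedgehog_body:
  assumes "balanced_hedgehog (2 * k + 1) t H"
  obtains S where "finite S" "card S = t" "S \<subseteq> verts H"
    and "\<And>X. X \<in> nsets S (k + 1) \<Longrightarrow> \<exists>e\<in>edges H. X \<subseteq> e"
proof -
  have half: "nat \<lceil>real (2 * k + 1) / 2\<rceil> = k + 1"
    by (simp add: nat_eq_iff ceiling_eq_iff)
  from assms obtain S where S: "finite S" "card S = t" "verts H = S \<union> \<Union>(edges H)"
    and spine: "\<forall>X\<in>nsets S (k + 1). \<exists>!e. e \<in> edges H \<and> e \<inter> S = X"
    unfolding balanced_hedgehog_def half by (elim conjE exE) (rule that)
  have "\<exists>e\<in>edges H. X \<subseteq> e" if "X \<in> nsets S (k + 1)" for X
    using bspec[OF spine that] by (metis inf_le1)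
  with S show thesis
    by (intro that[of S]) auto
qed

theorem lemma1p6:
  fixes k q t p q' :: nat and H :: "'a hypergraph"
  assumes "k > 0" and "q > 0" and "t > 0"
    and "p = (2 * k + 1) choose (k + 1)"
    and "q \<ge> p + 1"
    and "q' = q choose p"
    and "balanced_hedgehog (2 * k + 1) t H"
  shows "int (ramsey_number (2 * k + 1) H q' 2)
           > int (ramsey_number (k + 1) (complete_hypergraph (k + 1) t) q (p + 1)) - 1"
proof -
  define n where "n = ramsey_number (2 * k + 1) H q' 2"
  have H: "uniform_hypergraph (2 * k + 1) H"
    using assms(7) by (simp add: balanced_hedgehog_def)
  obtain S where S: "finite S" "card S = t" "S \<subseteq> verts H"
    and body: "\<And>X. X \<in> nsets S (k + 1) \<Longrightarrow> \<exists>e\<in>edges H. X \<subseteq> e"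
    using balanced_hedgehog_body[OF assms(7)] by blast
  have card_palettes: "card (nsets {..<q} p) = q'"
    unfolding assms(6) binomial_eq_nsets atLeast0LessThan ..
  \<comment> \<open>Colours are natural numbers below \<open>q'\<close>, so the p-sets of colours
    are numbered by a bijection.\<close>
  then obtain code where code: "bij_betw code (nsets {..<q} p) {..<q'}"
    using finite_same_card_bij[of "nsets {..<q} p" "{..<q'}"] by (auto simp: finite_imp_finite_nsets)
  \<comment> \<open>Over the integers, the strict inequality with \<open>- 1\<close> is exactly this
    weak one. It suffices that \<open>n\<close> vertices force the required copy for every colouring
    \<open>c\<close>.\<close>
  have "ramsey_number (k + 1) (complete_hypergraph (k + 1) t) q (p + 1) \<le> n"
  proof (rule ramsey_number_le)
    fix c :: "nat set \<Rightarrow> nat"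
    assume c: "c ` nsets {..<n} (k + 1) \<subseteq> {..<q}"
    \<comment> \<open>The edge \<open>e\<close> has exactly \<open>p\<close> subsets of size
      \<open>k + 1\<close>, hence at most \<open>p\<close> colours occur on them. As
      \<open>p \<le> q\<close>, these can be padded to exactly \<open>p\<close> colours; the fixed
      size is what makes the number of palettes \<open>q choose p\<close>.\<close>
    have "\<exists>P. P \<in> nsets {..<q} p \<and> c ` nsets e (k + 1) \<subseteq> P"
      if e: "e \<in> nsets {..<n} (2 * k + 1)" for e
    proof -
      have fin: "finite (nsets e (k + 1))"
        using e by (simp add: nsets_def)
      have "nsets e (k + 1) = {X. X \<subseteq> e \<and> card X = k + 1}"
        using e by (auto simp: nsets_def intro: finite_subset)
      then have "card (nsets e (k + 1)) = p"
        using e n_subsets[of e "k + 1"] assms(4) by (simp add: nsets_def)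
      then have "card (c ` nsets e (k + 1)) \<le> p"
        using card_image_le[OF fin, of c] by simp
      moreover have "c ` nsets e (k + 1) \<subseteq> {..<q}"
        using c e nsets_mono[of e "{..<n}" "k + 1"] by (auto simp: nsets_def)
      ultimately obtain P where "c ` nsets e (k + 1) \<subseteq> P" "P \<subseteq> {..<q}" "card P = p"
        using exists_subset_between[of "c ` nsets e (k + 1)" p "{..<q}"] assms(5) by auto
      then show ?thesis
        by (auto simp: nsets_def intro: finite_subset)
    qed
    then obtain palette where
      palette: "\<And>e. e \<in> nsets {..<n} (2 * k + 1) \<Longrightarrow> palette e \<in> nsets {..<q} p"
      and sub: "\<And>e. e \<in> nsets {..<n} (2 * k + 1) \<Longrightarrow> c ` nsets e (k + 1) \<subseteq> palette e"
      by metis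
    have "(code \<circ> palette) ` nsets {..<n} (2 * k + 1) \<subseteq> {..<q'}"
      using palette code by (auto simp: bij_betw_def)
    then obtain f where f: "embedding f H (complete_hypergraph (2 * k + 1) n)"
      and mono: "card ((\<lambda>e. (code \<circ> palette) (f ` e)) ` edges H) < 2"
      using ramsey_number_embedding[OF H, of 2] unfolding n_def by blast
    have inj: "inj_on f (verts H)" and fV: "f ` verts H \<subseteq> {..<n}"
      and fE: "\<And>e. e \<in> edges H \<Longrightarrow> f ` e \<in> nsets {..<n} (2 * k + 1)"
      using f by (auto simp: embedding_def)
    \<comment> \<open>Finiteness matters: an infinite set has \<open>card\<close> 0, so the bound
      \<open>< 2\<close> alone would not make the colouring constant on the copy.\<close>
    have fin: "finite (edges H)"
      using H by (meson finite_imp_finite_nsets finite_subset uniform_hypergraph_def)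
    have "card ((\<lambda>e. code (palette (f ` e))) ` edges H) \<le> Suc 0"
      using mono by simp
    then have "code (palette (f ` e)) = code (palette (f ` e'))"
      if "e \<in> edges H" "e' \<in> edges H" for e e'
      using that fin by (subst (asm) card_le_Suc0_iff_eq) blast+
    \<comment> \<open>Equal codes give equal palettes, since \<open>code\<close> is injective on the
      p-sets.\<close>
    then have eq: "palette (f ` e) = palette (f ` e')" if "e \<in> edges H" "e' \<in> edges H" for e e'
      using that palette fE code by (meson bij_betw_def inj_onD)
    \<comment> \<open>There may be no edges, namely when \<open>t \<le> k\<close>; then any set of
      \<open>p\<close> colours serves.\<close>
    obtain P where P: "finite P" "card P = p" "\<And>e. e \<in> edges H \<Longrightarrow> palette (f ` e) = P"
    proof (cases "edges H = {}")
      case True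
      then show thesis using that[of "{..<p}"] by simp
    next
      case False
      then obtain e where e: "e \<in> edges H" by blast
      then have "palette (f ` e) \<in> nsets {..<q} p"
        using palette fE by blast
      then have "finite (palette (f ` e))" "card (palette (f ` e)) = p"
        by (auto simp: nsets_def)
      then show thesis
        using that eq[OF _ e] by blast
    qed
    \<comment> \<open>The complete hypergraph lives on \<open>{..<t}\<close>, so the body is
      enumerated by \<open>b\<close>, and \<open>f \<circ> b\<close> places the clique on the image
      of the body.\<close>
    obtain b where b: "bij_betw b {..<t} S"
      using S finite_same_card_bij[of "{..<t}" S] by auto
    have emb: "embedding (f \<circ> b) (complete_hypergraph (k + 1) t) (complete_hypergraph (k + 1) n)"
    proof -
      have i: "inj_on (f \<circ> b) {..<t}"
        using b inj S(3) by (auto simp: bij_betw_def intro: comp_inj_on inj_on_subset)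
      moreover have r: "(f \<circ> b) ` {..<t} \<subseteq> {..<n}"
        using b fV S(3) by (auto simp: bij_betw_def)
      ultimately show ?thesis
        using nsets_image[OF i] nsets_mono[OF r]
        unfolding embedding_def edges_complete_hypergraph verts_complete_hypergraph by blast
    qed
    have "c ((f \<circ> b) ` Y) \<in> P" if Y: "Y \<in> nsets {..<t} (k + 1)" for Y
    proof -
      have X: "b ` Y \<in> nsets S (k + 1)"
        using b Y nsets_image[of b "{..<t}" Y] by (auto simp: bij_betw_def)
      then obtain e where e: "e \<in> edges H" "b ` Y \<subseteq> e"
        using body by blast
      have "e \<subseteq> verts H"
        using H e by (auto simp: uniform_hypergraph_def nsets_def)
      then have "inj_on f e"
        using inj inj_on_subset by blast
      moreover have "b ` Y \<in> nsets e (k + 1)"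
        using X e by (auto simp: nsets_def)
      ultimately have "f ` b ` Y \<in> nsets (f ` e) (k + 1)"
        by (rule nsets_image)
      then show ?thesis
        using sub[OF fE[OF e(1)]] P(3)[OF e(1)] by (auto simp: image_comp)
    qed
    then have "card ((\<lambda>e. c ((f \<circ> b) ` e)) ` nsets {..<t} (k + 1)) \<le> p"
      unfolding P(2)[symmetric] by (intro card_mono[OF P(1)]) blast
    then show "\<exists>g. embedding g (complete_hypergraph (k + 1) t) (complete_hypergraph (k + 1) n) \<and>
        card ((\<lambda>e. c (g ` e)) ` edges (complete_hypergraph (k + 1) t)) < p + 1"
      using emb by (intro exI[of _ "f \<circ> b"]) simp
  qed
  then show ?thesis
    by (simp add: n_def)
qed

end
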